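(* Let $1\le p\le\infty$ and let $n\ge1$ be an integer. Then $H_n^p(\mathbb C^+)$ embeds continuously into $H^\infty(\mathbb C^+)$. More precisely, there exists a constant $C$ with $0<C\le e^{1/e}$ such that $$\|F\|_{H^\infty}\le C\|F\|_{H_n^p}\qquad\text{for all }F\in H_n^p(\mathbb C^+).$$
   Context: $\mathbb C^+=\{z\in\mathbb C:\operatorname{Im} z>0\}$. For $1\le p<\infty$, $H^p(\mathbb C^+)$ is the space of holomorphic $F$ on $\mathbb C^+$ with $\|F\|_{H^p}=\sup_{y>0}\left(\int_{\mathbb R}|F(x+iy)|^p\,dx\right)^{1/p}<\infty$; $H^\infty(\mathbb C^+)$ is the space of bounded holomorphic functions with the sup norm $\|F\|_{H^\infty}$. $H_n^p(\mathbb C^+)$ is the space of holomorphic $F$ on $\mathbb C^+$ with $F^{(k)}\in H^p(\mathbb C^+)$ for $k=0,1,\dots,n$, with norm $\|F\|_{H_n^p}=\left(\sum_{k=0}^n\|F^{(k)}\|_{H^p}^p\right)^{1/p}$ if $1\le p<\infty$ and $\|F\|_{H_n^\infty}=\sum_{k=0}^n\|F^{(k)}\|_{H^\infty}$ if $p=\infty$. *)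

theory Defs
  imports "HOL-Analysis.Analysis"
begin

definition upper_half_plane :: "complex set" where
  "upper_half_plane = {z. Im z > 0}"

(* Used with exponents r > 0 only, so infinity is sent to infinity. *)
definition ennpowr :: "ennreal \<Rightarrow> real \<Rightarrow> ennreal" where
  "ennpowr a r = (if a = \<infinity> then \<infinity> else ennreal (enn2real a powr r))"

(* Functions are total on the complex numbers, but all norms and spaces below depend only
   on the values on the open upper half-plane. Norms take values in [0, infinity].
   The exponent p is meant to range over [1, infinity]. *)
definition hardy_norm :: "ennreal \<Rightarrow> (complex \<Rightarrow> complex) \<Rightarrow> ennreal" where
  "hardy_norm p F =
     (if p = \<infinity> then (SUP z\<in>upper_half_plane. ennreal (cmod (F z)))
      else (SUP y\<in>{0<..}.
              ennpowr (\<integral>\<^sup>+x. ennreal (cmod (F (Complex x y)) powr enn2real p) \<partial>lborel)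
                (1 / enn2real p)))"

definition hardy_space :: "ennreal \<Rightarrow> (complex \<Rightarrow> complex) set" where
  "hardy_space p =
     {F. F holomorphic_on upper_half_plane \<and>
         (if p = \<infinity> then bounded (F ` upper_half_plane) else hardy_norm p F < \<infinity>)}"

definition hardy_sobolev_space :: "nat \<Rightarrow> ennreal \<Rightarrow> (complex \<Rightarrow> complex) set" where
  "hardy_sobolev_space n p =
     {F. F holomorphic_on upper_half_plane \<and> (\<forall>k\<le>n. (deriv ^^ k) F \<in> hardy_space p)}"

definition hardy_sobolev_norm :: "nat \<Rightarrow> ennreal \<Rightarrow> (complex \<Rightarrow> complex) \<Rightarrow> ennreal" where
  "hardy_sobolev_norm n p F =
     (if p = \<infinity> then (\<Sum>k\<le>n. hardy_norm \<infinity> ((deriv ^^ k) F))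
      else ennpowr (\<Sum>k\<le>n. ennpowr (hardy_norm p ((deriv ^^ k) F)) (enn2real p))
             (1 / enn2real p))"

end

theory Submission
  imports Defs
begin

text \<open>
  The case \<open>p = \<infinity>\<close> holds with constant \<open>1\<close>, since the sup norm of \<open>F\<close> is itself a summand of
  the Sobolev norm. For finite \<open>p\<close> the embedding is a one-dimensional Sobolev inequality on each
  horizontal line, applied to \<open>f t = F (t + iy)\<close>, whose derivative is \<open>F' (t + iy)\<close>.

  Suppose first that \<open>f\<close> has no zeros, and integrate the derivative of \<open>(a + 1 - t) |f t|\<^sup>p\<close> over
  \<open>[a, a + 1]\<close>. The weight is \<open>1\<close> at the left endpoint and \<open>0\<close> at the right one, so
  \<open>|f a|\<^sup>p\<close> is at most the integral of \<open>|f|\<^sup>p + p |f|\<^bsup>p-1\<^esup> |f'|\<close>. Young's inequality bounds the second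
  term by \<open>(p - 1) |f|\<^sup>p + |f'|\<^sup>p\<close>, hence
  \<open>|f a|\<^sup>p \<le> p \<integral>|f|\<^sup>p + \<integral>|f'|\<^sup>p\<close> (lemma \<open>powr_le_integral_of_positive\<close>). Zeros of \<open>f\<close>, where
  \<open>|f|\<close> need not be differentiable, are treated by replacing \<open>|f|\<close> with \<open>sqrt (|f|\<^sup>2 + \<epsilon>)\<close> and
  letting \<open>\<epsilon>\<close> tend to \<open>0\<close> (lemma \<open>norm_powr_le_integral\<close>).

  Enlarging the interval to the whole line gives
  \<open>|F z|\<^sup>p \<le> p (\<parallel>F\<parallel>\<^sup>p + \<parallel>F'\<parallel>\<^sup>p)\<close> with the Hardy norms on the right. Both terms
  occur in the Sobolev norm because \<open>n \<ge> 1\<close>, so \<open>C = p\<^bsup>1/p\<^esup>\<close> is admissible; the maximum of this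
  function of \<open>p\<close>, attained at \<open>p = e\<close>, is the stated bound \<open>e\<^bsup>1/e\<^esup>\<close>.
\<close>

section \<open>A Sobolev inequality on an interval of unit length\<close>

text \<open>
  Young's inequality for the exponents \<open>p / (p - 1)\<close> and \<open>p\<close>, multiplied by \<open>p\<close>. The form with
  convex weights \<open>(p - 1) / p\<close> and \<open>1 / p\<close> covers \<open>p = 1\<close>, where the first exponent would be infinite.
\<close>

lemma young_powr:
  fixes s d p :: real
  assumes "1 \<le> p" "0 \<le> s" "0 \<le> d"
  shows "p * (s powr (p - 1) * d) \<le> (p - 1) * s powr p + d powr p"
proof (cases "s = 0 \<or> d = 0")
  case True
  then show ?thesis
    using assms by auto
next
  case False
  have "(s powr p) powr ((p-1)/p) * (d powr p) powr (1/p)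
      \<le> (p-1)/p * s powr p + 1/p * d powr p"
    using assms False by (intro Youngs_inequality_0) (auto simp: field_simps)
  moreover have "(s powr p) powr ((p-1)/p) = s powr (p-1)" "(d powr p) powr (1/p) = d"
    using assms by (auto simp: powr_powr)
  ultimately show ?thesis
    using assms by (simp add: field_simps)
qed

text \<open>
  Separating the bound \<open>d\<close> from the derivative \<open>s'\<close> lets a regularisation of \<open>|f|\<close> be
  compared with \<open>|f'|\<close> itself, so that only the first integral depends on the regularisation.
\<close>

lemma powr_le_integral_of_positive:
  fixes s s' d :: "real \<Rightarrow> real"
  assumes p: "1 \<le> p"
    and s_pos: "\<And>t. t \<in> {a..a+1} \<Longrightarrow> 0 < s t"
    and s_deriv: "\<And>t. t \<in> {a..a+1} \<Longrightarrow> (s has_real_derivative s' t) (at t within {a..a+1})"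
    and s'_le: "\<And>t. t \<in> {a..a+1} \<Longrightarrow> \<bar>s' t\<bar> \<le> d t"
    and d_int: "(\<lambda>t. d t powr p) integrable_on {a..a+1}"
  shows "s a powr p \<le> p * integral {a..a+1} (\<lambda>t. s t powr p) + integral {a..a+1} (\<lambda>t. d t powr p)"
proof -
  \<comment> \<open>The derivative of \<open>(a + 1 - t) * s t powr p\<close>.\<close>
  define H' where "H' t = (a + 1 - t) * (p * (s t powr (p - 1) * s' t)) - s t powr p" for t
  have s_cont: "continuous_on {a..a+1} s"
    using s_deriv DERIV_continuous_on by blast
  have sp_int: "(\<lambda>t. s t powr p) integrable_on {a..a+1}"
    using s_pos by (intro integrable_continuous_real continuous_intros s_cont) force
  have "(H' has_integral (a + 1 - (a+1)) * s (a+1) powr p - (a + 1 - a) * s a powr p) {a..a+1}"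
  proof (rule fundamental_theorem_of_calculus)
    fix t assume t: "t \<in> {a..a+1}"
    have pow: "((\<lambda>t. s t powr p) has_real_derivative (p * s t powr (p - 1) * s' t)) (at t within {a..a+1})"
      using DERIV_chain2[OF has_real_derivative_powr[OF s_pos[OF t]] s_deriv[OF t]] by simp
    have lin: "((\<lambda>t. a + 1 - t) has_real_derivative - 1) (at t within {a..a+1})"
      by (auto intro!: derivative_eq_intros)
    have "((\<lambda>t. (a + 1 - t) * s t powr p) has_real_derivative H' t) (at t within {a..a+1})"
      using DERIV_mult[OF lin pow] by (simp add: H'_def algebra_simps)
    then show "((\<lambda>t. (a + 1 - t) * s t powr p) has_vector_derivative H' t) (at t within {a..a+1})"
      by (simp add: has_real_derivative_iff_has_vector_derivative)
  qed simp
  from has_integral_neg[OF this] have H: "((\<lambda>t. - H' t) has_integral s a powr p) {a..a+1}"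
    by simp
  have "((\<lambda>t. p * s t powr p + d t powr p) has_integral
      p * integral {a..a+1} (\<lambda>t. s t powr p) + integral {a..a+1} (\<lambda>t. d t powr p)) {a..a+1}"
    by (intro has_integral_add has_integral_mult_right integrable_integral sp_int d_int)
  with H show ?thesis
  proof (rule has_integral_le)
    fix t assume t: "t \<in> {a..a+1}"
    have "- ((a + 1 - t) * (p * (s t powr (p - 1) * s' t)))
        \<le> \<bar>a + 1 - t\<bar> * (p * (s t powr (p - 1) * \<bar>s' t\<bar>))"
      using p by (intro order_trans[OF abs_ge_minus_self]) (simp add: abs_mult)
    also have "\<dots> \<le> 1 * (p * (s t powr (p - 1) * d t))"
      using t p s'_le[OF t] by (intro mult_mono) auto
    also have "\<dots> \<le> (p - 1) * s t powr p + d t powr p"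
      using young_powr[of p "s t" "d t"] p s_pos[OF t] s'_le[OF t] by simp
    finally show "- H' t \<le> p * s t powr p + d t powr p"
      by (simp add: H'_def algebra_simps)
  qed
qed

text \<open>
  The function \<open>sqrt (|f|\<^sup>2 + \<epsilon>)\<close> is positive and, by the Cauchy-Schwarz inequality, its
  derivative is bounded by \<open>|f'|\<close>, uniformly in \<open>\<epsilon>\<close>. Thus the inequality for positive functions
  applies, and both of its sides are continuous in \<open>\<epsilon> \<ge> 0\<close>.
\<close>

lemma norm_powr_le_integral:
  fixes f f' :: "real \<Rightarrow> 'a::real_inner"
  assumes p: "1 \<le> p"
    and f_deriv: "\<And>t. t \<in> {a..a+1} \<Longrightarrow> (f has_vector_derivative f' t) (at t within {a..a+1})"
    and f'_int: "(\<lambda>t. norm (f' t) powr p) integrable_on {a..a+1}"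
  shows "norm (f a) powr p \<le>
    p * integral {a..a+1} (\<lambda>t. norm (f t) powr p) + integral {a..a+1} (\<lambda>t. norm (f' t) powr p)"
proof -
  define s where "s \<epsilon> t = sqrt (f t \<bullet> f t + \<epsilon>)" for \<epsilon> t
  define R where "R \<epsilon> = p * integral {a..a+1} (\<lambda>t. s \<epsilon> t powr p)
      + integral {a..a+1} (\<lambda>t. norm (f' t) powr p)" for \<epsilon>
  have f_cont: "continuous_on {a..a+1} f"
    using f_deriv continuous_on_vector_derivative by blast
  have "s \<epsilon> a powr p \<le> R \<epsilon>" if "\<epsilon> > 0" for \<epsilon>
    unfolding R_def
  proof (rule powr_le_integral_of_positive[OF p])
    fix t assume t: "t \<in> {a..a+1}"
    have pos: "0 < f t \<bullet> f t + \<epsilon>"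
      using that by (simp add: add_nonneg_pos)
    then show "0 < s \<epsilon> t"
      by (simp add: s_def)
    have "((\<lambda>t. f t \<bullet> f t + \<epsilon>) has_real_derivative 2 * (f t \<bullet> f' t)) (at t within {a..a+1})"
      unfolding has_field_derivative_def
      by (rule has_derivative_eq_rhs, (rule derivative_intros f_deriv[OF t, unfolded has_vector_derivative_def])+)
         (auto simp: fun_eq_iff inner_commute)
    from DERIV_chain2[OF DERIV_real_sqrt[OF pos] this]
    show "(s \<epsilon> has_real_derivative (f t \<bullet> f' t) / s \<epsilon> t) (at t within {a..a+1})"
      by (simp add: s_def[abs_def] field_simps)
    have "norm (f t) \<le> s \<epsilon> t"
      using that by (simp add: s_def norm_eq_sqrt_inner)
    have "\<bar>f t \<bullet> f' t\<bar> \<le> norm (f t) * norm (f' t)"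
      by (rule Cauchy_Schwarz_ineq2)
    also have "\<dots> \<le> s \<epsilon> t * norm (f' t)"
      by (intro mult_right_mono) (use \<open>norm (f t) \<le> s \<epsilon> t\<close> in auto)
    finally show "\<bar>(f t \<bullet> f' t) / s \<epsilon> t\<bar> \<le> norm (f' t)"
      using \<open>0 < s \<epsilon> t\<close> by (simp add: abs_divide field_simps)
  qed (rule f'_int)
  moreover have "((\<lambda>\<epsilon>. s \<epsilon> a powr p) \<longlongrightarrow> s 0 a powr p) (at_right 0)"
    unfolding s_def using p by (intro tendsto_powr' tendsto_intros) (auto simp: eventually_at_filter)
  moreover have "(R \<longlongrightarrow> R 0) (at_right 0)"
  proof -
    have "continuous_on ({0..} \<times> cbox a (a+1)) (\<lambda>(\<epsilon>, t). s \<epsilon> t powr p)"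
      unfolding s_def split_beta using p
      by (intro continuous_on_powr' continuous_intros continuous_on_compose2[OF f_cont]) auto
    from integral_continuous_on_param[OF this]
    have "continuous_on {0..} R"
      unfolding R_def by (auto intro!: continuous_intros)
    then have "(R \<longlongrightarrow> R 0) (at 0 within {0..})"
      by (simp add: continuous_on_def)
    then show ?thesis
      by (rule tendsto_within_subset) auto
  qed
  ultimately have "s 0 a powr p \<le> R 0"
    by (intro tendsto_le[of "at_right 0" R "R 0" "\<lambda>\<epsilon>. s \<epsilon> a powr p"])
       (auto simp: eventually_at_filter)
  then show ?thesis
    by (simp add: R_def s_def norm_eq_sqrt_inner)
qed

section \<open>Extended nonnegative reals\<close>

text \<open>
  The left-hand integral is a gauge integral over \<open>S\<close>, the right-hand one a Lebesgue integral over the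
  whole space; this is how the local estimate is passed on to the integrals in the Hardy norm.
\<close>

lemma ennreal_integral_le_nn_integral:
  fixes g :: "'a::euclidean_space \<Rightarrow> real"
  assumes "g integrable_on S" "\<And>x. 0 \<le> g x"
  shows "ennreal (integral S g) \<le> (\<integral>\<^sup>+x. ennreal (g x) \<partial>lborel)"
proof -
  have "ennreal (integral S g) = (\<integral>\<^sup>+x. indicator S x * ennreal (g x) \<partial>lborel)"
    using nn_integral_has_integral_lebesgue[of S g "integral S g"] assms
    by (simp add: integrable_integral ennreal_mult' flip: ennreal_indicator)
  also have "\<dots> \<le> (\<integral>\<^sup>+x. ennreal (g x) \<partial>lborel)"
    by (intro nn_integral_mono) (auto split: split_indicator)
  finally show ?thesis .
qed

lemma ennpowr_mono:
  assumes "a \<le> b" "0 \<le> r"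
  shows "ennpowr a r \<le> ennpowr b r"
  using assms unfolding ennpowr_def
  by (auto simp: top_unique less_top intro!: ennreal_leI powr_mono2 enn2real_mono)

lemma ennpowr_ennpowr_inverse:
  assumes "0 < r"
  shows "ennpowr (ennpowr a (1 / r)) r = a"
  using assms by (cases a) (auto simp: ennpowr_def powr_powr)

lemma ennpowr_mult:
  assumes "0 < c"
  shows "ennpowr (ennreal c * a) r = ennreal (c powr r) * ennpowr a r"
proof (cases a)
  case (real x)
  then show ?thesis
    using assms by (simp add: ennpowr_def powr_mult flip: ennreal_mult)
next
  case top
  then show ?thesis
    using assms by (simp add: ennpowr_def ennreal_mult_top)
qed

text \<open>
  Equivalently \<open>x \<le> exp (x / e)\<close>, which is the tangent line inequality \<open>1 + u \<le> exp u\<close> at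
  \<open>u = x / e - 1\<close>.
\<close>

lemma self_powr_inverse_le:
  fixes x :: real
  assumes "0 < x"
  shows "x powr (1 / x) \<le> exp (1 / exp 1)"
proof -
  have "x \<le> exp (x / exp 1)"
    using exp_ge_add_one_self[of "x / exp 1 - 1"] unfolding exp_diff by (simp add: divide_le_cancel)
  then have "x powr (1/x) \<le> exp (x / exp 1) powr (1/x)"
    using assms by (intro powr_mono2) auto
  also have "\<dots> = exp (1 / exp 1)"
    using assms by (simp add: powr_def)
  finally show ?thesis .
qed

section \<open>Hardy spaces on the upper half-plane\<close>

text \<open>
  The interval inequality on the segment from \<open>z\<close> to \<open>z + 1\<close>, which lies in the half-plane. The
  factor \<open>p \<ge> 1\<close> is put in front of the second integral as well, in order to match the symmetric way
  in which \<open>F\<close> and its derivative enter the Sobolev norm.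
\<close>

lemma cmod_powr_le_line_integrals:
  assumes p: "1 \<le> p"
    and F: "F holomorphic_on upper_half_plane"
    and F': "continuous_on upper_half_plane (deriv F)"
    and z: "z \<in> upper_half_plane"
  shows "ennreal (cmod (F z) powr p) \<le> ennreal p *
    ((\<integral>\<^sup>+x. ennreal (cmod (F (Complex x (Im z))) powr p) \<partial>lborel)
     + (\<integral>\<^sup>+x. ennreal (cmod (deriv F (Complex x (Im z))) powr p) \<partial>lborel))"
proof -
  define a where "a = Re z"
  define l where "l t = Complex t (Im z)" for t
  have l_deriv: "(l has_vector_derivative 1) (at t within T)" for t T
    unfolding l_def Complex_eq by (auto intro!: derivative_eq_intros)
  have l_in: "l t \<in> upper_half_plane" for t
    using z by (simp add: l_def upper_half_plane_def)
  have l_cont: "continuous_on T l" for T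
    unfolding l_def Complex_eq by (intro continuous_intros)
  have op: "open upper_half_plane"
    unfolding upper_half_plane_def by (rule open_halfspace_Im_gt)
  have deriv: "((\<lambda>t. F (l t)) has_vector_derivative deriv F (l t)) (at t within T)" for t T
  proof -
    have "(F has_field_derivative deriv F (l t)) (at (l t))"
      using F op l_in by (rule holomorphic_derivI)
    from field_vector_diff_chain_within[OF l_deriv has_field_derivative_at_within[OF this]]
    show ?thesis
      by (simp add: o_def)
  qed
  have int: "(\<lambda>t. cmod (G (l t)) powr p) integrable_on {a..a+1}"
    if "continuous_on upper_half_plane G" for G
    using p l_in
    by (intro integrable_continuous_real continuous_on_powr' continuous_intros
        continuous_on_compose2[OF that l_cont]) auto
  have "cmod (F (l a)) powr p \<le> p * integral {a..a+1} (\<lambda>t. cmod (F (l t)) powr p)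
      + integral {a..a+1} (\<lambda>t. cmod (deriv F (l t)) powr p)" (is "_ \<le> p * ?A + ?B")
    using p deriv int[OF F'] by (rule norm_powr_le_integral)
  also have "\<dots> \<le> p * (?A + ?B)"
    using p mult_right_mono[of 1 p ?B] by (simp add: distrib_left integral_nonneg int[OF F'])
  finally have "ennreal (cmod (F (l a)) powr p) \<le> ennreal (p * (?A + ?B))"
    by (rule ennreal_leI)
  also have "\<dots> = ennreal p * (ennreal ?A + ennreal ?B)"
    using p int[OF F'] int[OF holomorphic_on_imp_continuous_on[OF F]]
    by (simp add: ennreal_mult integral_nonneg)
  also have "\<dots> \<le> ennreal p *
    ((\<integral>\<^sup>+x. ennreal (cmod (F (l x)) powr p) \<partial>lborel)
     + (\<integral>\<^sup>+x. ennreal (cmod (deriv F (l x)) powr p) \<partial>lborel))"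
    using int[OF F'] int[OF holomorphic_on_imp_continuous_on[OF F]]
    by (intro mult_left_mono add_mono ennreal_integral_le_nn_integral) auto
  finally show ?thesis
    by (simp add: l_def a_def)
qed

lemma line_integral_le_hardy_norm:
  assumes "0 < enn2real p" "p \<noteq> \<infinity>" "0 < y"
  shows "(\<integral>\<^sup>+x. ennreal (cmod (F (Complex x y)) powr enn2real p) \<partial>lborel)
    \<le> ennpowr (hardy_norm p F) (enn2real p)"
proof -
  let ?I = "\<integral>\<^sup>+x. ennreal (cmod (F (Complex x y)) powr enn2real p) \<partial>lborel"
  have "ennpowr ?I (1 / enn2real p) \<le> hardy_norm p F"
    using assms unfolding hardy_norm_def by (auto intro!: SUP_upper2[of y])
  then have "ennpowr (ennpowr ?I (1 / enn2real p)) (enn2real p)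
      \<le> ennpowr (hardy_norm p F) (enn2real p)"
    using assms by (intro ennpowr_mono) auto
  then show ?thesis
    using assms by (simp add: ennpowr_ennpowr_inverse)
qed

lemma hardy_norm_infinity_le:
  assumes p: "1 \<le> p" "p \<noteq> \<infinity>" and n: "1 \<le> n"
    and F: "F \<in> hardy_sobolev_space n p"
  shows "hardy_norm \<infinity> F
    \<le> ennreal (enn2real p powr (1 / enn2real p)) * hardy_sobolev_norm n p F"
proof -
  define P where "P = enn2real p"
  define N where "N k = ennpowr (hardy_norm p ((deriv ^^ k) F)) P" for k
  have P: "1 \<le> P"
    using enn2real_mono[of 1 p] p by (simp add: P_def less_top)
  have hol: "(deriv ^^ k) F holomorphic_on upper_half_plane" if "k \<le> n" for k
    using F that by (auto simp: hardy_sobolev_space_def hardy_space_def)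
  have "ennreal (cmod (F z)) \<le> ennreal (P powr (1 / P)) * ennpowr (\<Sum>k\<le>n. N k) (1 / P)"
    if z: "z \<in> upper_half_plane" for z
  proof -
    have "ennreal (cmod (F z) powr P) \<le> ennreal P *
        ((\<integral>\<^sup>+x. ennreal (cmod (F (Complex x (Im z))) powr P) \<partial>lborel)
         + (\<integral>\<^sup>+x. ennreal (cmod (deriv F (Complex x (Im z))) powr P) \<partial>lborel))"
      using P hol[of 0] hol[of 1] n z
      by (intro cmod_powr_le_line_integrals holomorphic_on_imp_continuous_on) auto
    also have "\<dots> \<le> ennreal P * (N 0 + N 1)"
      using P p z unfolding P_def N_def
      by (intro mult_left_mono add_mono)
         (auto intro!: line_integral_le_hardy_norm simp: upper_half_plane_def)
    also have "N 0 + N 1 = (\<Sum>k\<in>{0, 1}. N k)"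
      by simp
    also have "\<dots> \<le> (\<Sum>k\<le>n. N k)"
      using n by (intro sum_mono2) auto
    finally have "ennreal (cmod (F z) powr P) \<le> ennreal P * (\<Sum>k\<le>n. N k)"
      by (simp add: mult_left_mono)
    then have "ennpowr (ennreal (cmod (F z) powr P)) (1 / P)
        \<le> ennpowr (ennreal P * (\<Sum>k\<le>n. N k)) (1 / P)"
      using P by (intro ennpowr_mono) auto
    then show ?thesis
      using P by (simp add: ennpowr_mult) (simp add: ennpowr_def powr_powr)
  qed
  then have "(SUP z\<in>upper_half_plane. ennreal (cmod (F z)))
      \<le> ennreal (P powr (1 / P)) * ennpowr (\<Sum>k\<le>n. N k) (1 / P)"
    by (rule SUP_least)
  then show ?thesis
    using p by (simp add: hardy_norm_def[of top] hardy_sobolev_norm_def N_def P_def)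
qed

lemma hardy_sobolev_norm_finite:
  assumes "p \<noteq> \<infinity>" "F \<in> hardy_sobolev_space n p"
  shows "hardy_sobolev_norm n p F < \<infinity>"
proof -
  have "ennpowr a r < \<infinity>" if "a < \<infinity>" for a r
    using that by (auto simp: ennpowr_def)
  moreover have "hardy_norm p ((deriv ^^ k) F) < \<infinity>" if "k \<le> n" for k
    using assms that by (auto simp: hardy_sobolev_space_def hardy_space_def)
  ultimately show ?thesis
    using assms by (simp add: hardy_sobolev_norm_def)
qed

lemma hardy_space_infinityI:
  assumes "F holomorphic_on upper_half_plane" "hardy_norm \<infinity> F < \<infinity>"
  shows "F \<in> hardy_space \<infinity>"
proof -
  obtain M where M: "hardy_norm \<infinity> F = ennreal M" "0 \<le> M"
    using assms(2) by (cases "hardy_norm \<infinity> F") auto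
  have "cmod (F z) \<le> M" if "z \<in> upper_half_plane" for z
  proof -
    have "ennreal (cmod (F z)) \<le> hardy_norm \<infinity> F"
      using that by (auto simp: hardy_norm_def intro: SUP_upper)
    then show ?thesis
      using M by simp
  qed
  then show ?thesis
    using assms(1) by (auto simp: hardy_space_def bounded_iff)
qed

section \<open>The embedding\<close>

theorem proposition3p5:
  fixes p :: ennreal and n :: nat
  assumes "1 \<le> p" and "n \<ge> 1"
  shows "hardy_sobolev_space n p \<subseteq> hardy_space \<infinity> \<and>
         (\<exists>C::real. 0 < C \<and> C \<le> exp (1 / exp 1) \<and>
           (\<forall>F\<in>hardy_sobolev_space n p.
              hardy_norm \<infinity> F \<le> ennreal C * hardy_sobolev_norm n p F))"
proof (cases "p = \<infinity>")
  case True
  have "hardy_norm \<infinity> F \<le> hardy_sobolev_norm n \<infinity> F" for F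
    using member_le_sum[of 0 "{..n}" "\<lambda>k. hardy_norm \<infinity> ((deriv ^^ k) F)"]
    by (simp add: hardy_sobolev_norm_def)
  moreover have "F \<in> hardy_space \<infinity>" if "F \<in> hardy_sobolev_space n \<infinity>" for F
    using that by (force simp: hardy_sobolev_space_def dest: spec[of _ 0])
  ultimately show ?thesis
    using True by (auto intro!: exI[of _ 1])
next
  case False
  have P: "1 \<le> enn2real p"
    using enn2real_mono[of 1 p] assms False by (simp add: less_top)
  define C where "C = enn2real p powr (1 / enn2real p)"
  have bound: "hardy_norm \<infinity> F \<le> ennreal C * hardy_sobolev_norm n p F"
    if "F \<in> hardy_sobolev_space n p" for F
    using hardy_norm_infinity_le[OF assms(1) False assms(2) that] by (simp add: C_def)
  have "F \<in> hardy_space \<infinity>" if F: "F \<in> hardy_sobolev_space n p" for F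
  proof (rule hardy_space_infinityI)
    show "F holomorphic_on upper_half_plane"
      using F by (simp add: hardy_sobolev_space_def)
    show "hardy_norm \<infinity> F < \<infinity>"
      using hardy_sobolev_norm_finite[OF False F]
      by (intro le_less_trans[OF bound[OF F]]) (simp add: ennreal_mult_less_top)
  qed
  moreover have "0 < C" "C \<le> exp (1 / exp 1)"
    using P self_powr_inverse_le[of "enn2real p"] by (auto simp: C_def)
  ultimately show ?thesis
    using bound by blast
qed

end
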